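(* The lax functor $\tilde H:\mathcal V\text{-}\mathsf{Mod}\to\mathcal V\text{-}\mathsf{Mod}$ belongs to a lax monad $\tilde{\mathbb H}=(\tilde H,\delta,\nu)$ of $\mathcal V\text{-}\mathsf{Mod}$ such that the Hausdorff monad $\mathbb H=(H,\{-\},\bigcup)$ of $\mathcal V\text{-}\mathsf{Cat}$ is a lifting of $\tilde{\mathbb H}$ along $(-)_*:\mathcal V\text{-}\mathsf{Cat}\to\mathcal V\text{-}\mathsf{Mod}$.
   Context: $\mathcal V$ is a commutative unital quantale: a complete lattice with a commutative, associative operation $\otimes$ with neutral element $k$, such that $\otimes$ preserves arbitrary suprema in each variable; it is assumed that $k>\bot$. The internal hom $\multimap$ of $\mathcal V$ is given by $z\le x\multimap y\iff z\otimes x\le y$. A $\mathcal V$-category $X=(X,a)$ is a set $X$ with $a:X\times X\to\mathcal V$ satisfying $k\le a(x,x)$ and $a(x,y)\otimes a(y,z)\le a(x,z)$; one writes $1_X^*:=a$. A $\mathcal V$-functor $f:(X,a)\to(Y,b)$ is a map with $a(x,y)\le b(f(x),f(y))$. A $\mathcal V$-module $\varphi:X\to Y$ is a function $\varphi:X\times Y\to\mathcal V$ with $a(x',x)\otimes\varphi(x,y)\le\varphi(x',y)$ and $\varphi(x,y)\otimes b(y,y')\le\varphi(x,y')$; composition is $(\psi\cdot\varphi)(x,z)=\bigvee_{y}\varphi(x,y)\otimes\psi(y,z)$, with identities $1_X^*$; hom-sets of $\mathcal V\text{-}\mathsf{Mod}$ are ordered pointwise. For $f:(X,a)\to(Y,b)$: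 $f_*:X\to Y$, $f_*(x,y)=b(f(x),y)$, and $f^*:Y\to X$, $f^*(y,x)=b(y,f(x))$. $\hat X$ is the $\mathcal V$-category of functions $t:X\to\mathcal V$ with $a(x',x)\otimes t(x)\le t(x')$, with structure $1_{\hat X}^*(t,s)=\bigwedge_x t(x)\multimap s(x)$; $y_X:X\to\hat X$, $y_X(x)=a(-,x)$; for a module $\varphi:X\to Y$, $y_\varphi:Y\to\hat X$, $y_\varphi(y)=\varphi(-,y)$. The Hausdorff monad $\mathbb H=(H,\{-\},\bigcup)$ on $\mathcal V\text{-}\mathsf{Cat}$: $HX=(PX,h_X)$ with $PX$ the powerset and $h_X(A,B)=\bigwedge_{x\in A}\bigvee_{y\in B}a(x,y)$, $Hf(A)=f(A)$, unit $x\mapsto\{x\}$, multiplication $\mathcal A\mapsto\bigcup\mathcal A$. $\tilde H$ is defined by $\tilde HX=HX$ and $\tilde H\varphi=(Hy_\varphi)^*\cdot(Hy_X)_*$. A lax functor $T$ on $\mathcal V\text{-}\mathsf{Mod}$ satisfies $1_{TX}^*\le T(1_X^* )$ and $T\psi\cdot T\varphi\le T(\psi\cdot\varphi)$. A lax monad $(T,\delta,\nu)$ consists here of a lax functor $T$ and families of modules $\delta_X:X\to TX$, $\nu_X:TTX\to TX$, natural in $X$ with respect to modules ($T\varphi\cdot\delta_X=\delta_Y\cdot\varphi$ and $T\varphi\cdot\nu_X=\nu_Y\cdot TT\varphi$), satisfying the monad laws $\nu_X\cdot\delta_{TX}=1^*_{TX}=\nu_X\cdot T\delta_X$ and $\nu_X\cdot\nu_{TX}=\nu_X\cdot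 T\nu_X$. That $\mathbb H$ is a lifting of $\tilde{\mathbb H}$ along $(-)_*$ means $\tilde H(f_* )=(Hf)_*$ for all $\mathcal V$-functors $f$, $\delta_X=(\{-\}_X)_*$ and $\nu_X=(\bigcup_X)_*$. *)

theory Defs
  imports Main "HOL-Library.FuncSet"
begin

text \<open>
  A commutative unital quantale with neutral element \<open>1\<close>; the case \<open>A = {}\<close> of the distributive
  law gives \<open>a * bot = bot\<close>, and commutativity gives the law in the other variable.
\<close>

class comm_unital_quantale = complete_lattice + comm_monoid_mult +
  assumes mult_Sup: "a * Sup A = (SUP b\<in>A. a * b)"
    and bot_less_one: "bot < 1"

definition qhom :: "'v::comm_unital_quantale \<Rightarrow> 'v \<Rightarrow> 'v"
  where "qhom x y = Sup {z. z * x \<le> y}"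

lemma quantale_mult_right_mono:
  fixes a b c :: "'v::comm_unital_quantale"
  assumes "a \<le> b"
  shows "c * a \<le> c * b"
proof -
  have "c * b = c * Sup {a, b}"
    using assms by (simp add: sup.absorb2)
  also have "\<dots> = sup (c * a) (c * b)"
    by (simp only: mult_Sup) simp
  finally show ?thesis
    by (metis sup.cobounded1)
qed

lemma quantale_mult_mono:
  fixes a b c d :: "'v::comm_unital_quantale"
  assumes "a \<le> b" "c \<le> d"
  shows "a * c \<le> b * d"
  by (metis assms mult.commute order_trans quantale_mult_right_mono)

lemma le_qhom_iff:
  fixes x y z :: "'v::comm_unital_quantale"
  shows "z \<le> qhom x y \<longleftrightarrow> z * x \<le> y"
proof
  assume "z \<le> qhom x y"
  then have "z * x \<le> x * qhom x y"
    by (metis mult.commute quantale_mult_right_mono)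
  also have "\<dots> = (SUP w\<in>{z. z * x \<le> y}. x * w)"
    by (simp add: qhom_def mult_Sup)
  also have "\<dots> \<le> y"
    by (auto intro!: SUP_least simp: mult.commute)
  finally show "z * x \<le> y" .
next
  assume "z * x \<le> y"
  then show "z \<le> qhom x y"
    unfolding qhom_def by (intro Sup_upper) simp
qed

text \<open>
  A \<open>\<V>\<close>-category has an arbitrary (possibly empty) carrier set inside a type. All structure
  functions, modules and maps are \<^const>\<open>extensional\<close>, so that equality of HOL functions
  is equality of functions on the carriers and the order of HOL functions is the pointwise order
  of modules.
\<close>

record ('a, 'v) vcat =
  ob :: "'a set"
  hom :: "'a \<times> 'a \<Rightarrow> 'v"

definition vcategory :: "('a, 'v::comm_unital_quantale) vcat \<Rightarrow> bool"
  where "vcategory X \<longleftrightarrow>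
    hom X \<in> extensional (ob X \<times> ob X) \<and>
    (\<forall>x\<in>ob X. 1 \<le> hom X (x, x)) \<and>
    (\<forall>x\<in>ob X. \<forall>y\<in>ob X. \<forall>z\<in>ob X. hom X (x, y) * hom X (y, z) \<le> hom X (x, z))"

definition vfunctor ::
  "('a, 'v::comm_unital_quantale) vcat \<Rightarrow> ('b, 'v) vcat \<Rightarrow> ('a \<Rightarrow> 'b) \<Rightarrow> bool"
  where "vfunctor X Y f \<longleftrightarrow>
    f \<in> ob X \<rightarrow>\<^sub>E ob Y \<and>
    (\<forall>x\<in>ob X. \<forall>y\<in>ob X. hom X (x, y) \<le> hom Y (f x, f y))"

definition vmodule ::
  "('a, 'v::comm_unital_quantale) vcat \<Rightarrow> ('b, 'v) vcat \<Rightarrow> ('a \<times> 'b \<Rightarrow> 'v) \<Rightarrow> bool"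
  where "vmodule X Y \<phi> \<longleftrightarrow>
    \<phi> \<in> extensional (ob X \<times> ob Y) \<and>
    (\<forall>x'\<in>ob X. \<forall>x\<in>ob X. \<forall>y\<in>ob Y. hom X (x', x) * \<phi> (x, y) \<le> \<phi> (x', y)) \<and>
    (\<forall>x\<in>ob X. \<forall>y\<in>ob Y. \<forall>y'\<in>ob Y. \<phi> (x, y) * hom Y (y, y') \<le> \<phi> (x, y'))"

text \<open>
  \<open>mcomp X Y Z \<psi> \<phi>\<close> is the composite \<open>\<psi> \<cdot> \<phi>\<close> of \<open>\<phi> : X \<rightarrow> Y\<close> and
  \<open>\<psi> : Y \<rightarrow> Z\<close>; the identity module of \<open>X\<close> is \<open>hom X\<close>.
\<close>

definition mcomp ::
  "('a, 'v::comm_unital_quantale) vcat \<Rightarrow> ('b, 'v) vcat \<Rightarrow> ('c, 'v) vcat \<Rightarrow>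
    ('b \<times> 'c \<Rightarrow> 'v) \<Rightarrow> ('a \<times> 'b \<Rightarrow> 'v) \<Rightarrow> ('a \<times> 'c \<Rightarrow> 'v)"
  where "mcomp X Y Z \<psi> \<phi> =
    (\<lambda>(x, z)\<in>ob X \<times> ob Z. SUP y\<in>ob Y. \<phi> (x, y) * \<psi> (y, z))"

definition lower_star ::
  "('a, 'v::comm_unital_quantale) vcat \<Rightarrow> ('b, 'v) vcat \<Rightarrow> ('a \<Rightarrow> 'b) \<Rightarrow> ('a \<times> 'b \<Rightarrow> 'v)"
  where "lower_star X Y f = (\<lambda>(x, y)\<in>ob X \<times> ob Y. hom Y (f x, y))"

definition upper_star ::
  "('a, 'v::comm_unital_quantale) vcat \<Rightarrow> ('b, 'v) vcat \<Rightarrow> ('a \<Rightarrow> 'b) \<Rightarrow> ('b \<times> 'a \<Rightarrow> 'v)"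
  where "upper_star X Y f = (\<lambda>(y, x)\<in>ob Y \<times> ob X. hom Y (y, f x))"

definition presheaves :: "('a, 'v::comm_unital_quantale) vcat \<Rightarrow> ('a \<Rightarrow> 'v, 'v) vcat"
  where "presheaves X =
    (let P = {t \<in> extensional (ob X). \<forall>x'\<in>ob X. \<forall>x\<in>ob X. hom X (x', x) * t x \<le> t x'}
     in \<lparr>ob = P, hom = (\<lambda>(t, s)\<in>P \<times> P. INF x\<in>ob X. qhom (t x) (s x))\<rparr>)"

definition yoneda :: "('a, 'v::comm_unital_quantale) vcat \<Rightarrow> 'a \<Rightarrow> ('a \<Rightarrow> 'v)"
  where "yoneda X = (\<lambda>x\<in>ob X. \<lambda>x'\<in>ob X. hom X (x', x))"

definition yoneda_mod ::
  "('a, 'v::comm_unital_quantale) vcat \<Rightarrow> ('b, 'v) vcat \<Rightarrow> ('a \<times> 'b \<Rightarrow> 'v) \<Rightarrow> 'b \<Rightarrow> ('a \<Rightarrow> 'v)"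
  where "yoneda_mod X Y \<phi> = (\<lambda>y\<in>ob Y. \<lambda>x\<in>ob X. \<phi> (x, y))"

definition haus :: "('a, 'v::comm_unital_quantale) vcat \<Rightarrow> ('a set, 'v) vcat"
  where "haus X =
    \<lparr>ob = Pow (ob X),
     hom = (\<lambda>(A, B)\<in>Pow (ob X) \<times> Pow (ob X). INF x\<in>A. SUP y\<in>B. hom X (x, y))\<rparr>"

definition haus_map :: "('a, 'v::comm_unital_quantale) vcat \<Rightarrow> ('a \<Rightarrow> 'b) \<Rightarrow> ('a set \<Rightarrow> 'b set)"
  where "haus_map X f = (\<lambda>A\<in>ob (haus X). f ` A)"

definition haus_unit :: "('a, 'v::comm_unital_quantale) vcat \<Rightarrow> 'a \<Rightarrow> 'a set"
  where "haus_unit X = (\<lambda>x\<in>ob X. {x})"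

definition haus_mult :: "('a, 'v::comm_unital_quantale) vcat \<Rightarrow> 'a set set \<Rightarrow> 'a set"
  where "haus_mult X = (\<lambda>\<A>\<in>ob (haus (haus X)). \<Union>\<A>)"

text \<open>
  The action of \<open>\<tilde>H\<close> on modules; on objects it is \<^const>\<open>haus\<close>.
\<close>

definition haus_mod ::
  "('a, 'v::comm_unital_quantale) vcat \<Rightarrow> ('b, 'v) vcat \<Rightarrow> ('a \<times> 'b \<Rightarrow> 'v) \<Rightarrow> ('a set \<times> 'b set \<Rightarrow> 'v)"
  where "haus_mod X Y \<phi> =
    mcomp (haus X) (haus (presheaves X)) (haus Y)
      (upper_star (haus Y) (haus (presheaves X)) (haus_map Y (yoneda_mod X Y \<phi>)))
      (lower_star (haus X) (haus (presheaves X)) (haus_map X (yoneda X)))"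

text \<open>
  The families of modules \<open>\<delta>\<close> and \<open>\<nu>\<close>. They are forced by the requirement that the Hausdorff
  monad be a lifting.
\<close>

definition haus_delta :: "('a, 'v::comm_unital_quantale) vcat \<Rightarrow> ('a \<times> 'a set \<Rightarrow> 'v)"
  where "haus_delta X = lower_star X (haus X) (haus_unit X)"

definition haus_nu :: "('a, 'v::comm_unital_quantale) vcat \<Rightarrow> ('a set set \<times> 'a set \<Rightarrow> 'v)"
  where "haus_nu X = lower_star (haus (haus X)) (haus X) (haus_mult X)"

lemma ob_haus [simp]: "ob (haus X) = Pow (ob X)"
  by (simp add: haus_def)

lemma hom_haus:
  "A \<subseteq> ob X \<Longrightarrow> B \<subseteq> ob X \<Longrightarrow> hom (haus X) (A, B) = (INF x\<in>A. SUP y\<in>B. hom X (x, y))"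
  by (simp add: haus_def)

lemma le_hom_haus:
  assumes "A \<subseteq> ob X" "B \<subseteq> ob X" "\<And>x. x \<in> A \<Longrightarrow> v \<le> (SUP y\<in>B. hom X (x, y))"
  shows "v \<le> hom (haus X) (A, B)"
  using assms by (simp add: hom_haus le_INF_iff)

lemma hom_haus_le:
  assumes "A \<subseteq> ob X" "B \<subseteq> ob X" "x \<in> A"
  shows "hom (haus X) (A, B) \<le> (SUP y\<in>B. hom X (x, y))"
  using assms by (simp only: hom_haus) (rule INF_lower)

lemma vcategory_haus:
  fixes X :: "('a, 'v::comm_unital_quantale) vcat"
  assumes X: "vcategory X"
  shows "vcategory (haus X)"
  unfolding vcategory_def
proof (intro conjI ballI)
  show "hom (haus X) \<in> extensional (ob (haus X) \<times> ob (haus X))"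
    by (simp add: haus_def)
next
  fix A assume "A \<in> ob (haus X)"
  then have A: "A \<subseteq> ob X" by simp
  show "1 \<le> hom (haus X) (A, A)"
  proof (rule le_hom_haus)
    fix x assume x: "x \<in> A"
    have "1 \<le> hom X (x, x)"
      using X A x unfolding vcategory_def by blast
    then show "1 \<le> (SUP y\<in>A. hom X (x, y))"
      by (rule SUP_upper2[OF x])
  qed (fact A)+
next
  fix A B C assume "A \<in> ob (haus X)" "B \<in> ob (haus X)" "C \<in> ob (haus X)"
  then have sub: "A \<subseteq> ob X" "B \<subseteq> ob X" "C \<subseteq> ob X" by auto
  show "hom (haus X) (A, B) * hom (haus X) (B, C) \<le> hom (haus X) (A, C)"
  proof (rule le_hom_haus)
    fix x assume x: "x \<in> A"
    let ?h = "hom (haus X) (B, C)"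
    have "hom (haus X) (A, B) * ?h \<le> (SUP y\<in>B. hom X (x, y)) * ?h"
      using hom_haus_le[OF sub(1,2) x] order_refl by (rule quantale_mult_mono)
    also have "\<dots> = ?h * (SUP y\<in>B. hom X (x, y))"
      by (rule mult.commute)
    also have "\<dots> = (SUP y\<in>B. hom X (x, y) * ?h)"
      by (simp only: mult_Sup image_image mult.commute[of ?h])
    also have "\<dots> \<le> (SUP z\<in>C. hom X (x, z))"
    proof (rule SUP_least)
      fix y assume y: "y \<in> B"
      have "hom X (x, y) * ?h \<le> hom X (x, y) * (SUP z\<in>C. hom X (y, z))"
        using hom_haus_le[OF sub(2,3) y] by (rule quantale_mult_right_mono)
      also have "\<dots> = (SUP z\<in>C. hom X (x, y) * hom X (y, z))"
        by (simp only: mult_Sup image_image)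
      also have "\<dots> \<le> (SUP z\<in>C. hom X (x, z))"
      proof (rule SUP_mono)
        fix z assume z: "z \<in> C"
        then have "hom X (x, y) * hom X (y, z) \<le> hom X (x, z)"
          using X x y sub unfolding vcategory_def by blast
        then show "\<exists>z'\<in>C. hom X (x, y) * hom X (y, z) \<le> hom X (x, z')"
          using z by blast
      qed
      finally show "hom X (x, y) * ?h \<le> (SUP z\<in>C. hom X (x, z))" .
    qed
    finally show "hom (haus X) (A, B) * ?h \<le> (SUP z\<in>C. hom X (x, z))" .
  qed (use sub in auto)
qed

lemma vfunctor_haus_map:
  fixes X :: "('a, 'v::comm_unital_quantale) vcat" and Y :: "('b, 'v) vcat"
  assumes f: "vfunctor X Y f"
  shows "vfunctor (haus X) (haus Y) (haus_map X f)"
proof -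
  have im: "f ` A \<subseteq> ob Y" if "A \<subseteq> ob X" for A
    using f that by (auto simp: vfunctor_def)
  have "hom (haus X) (A, B) \<le> hom (haus Y) (f ` A, f ` B)" if "A \<subseteq> ob X" "B \<subseteq> ob X" for A B
  proof (rule le_hom_haus)
    fix y assume "y \<in> f ` A"
    then obtain x where x: "x \<in> A" "y = f x" by auto
    have "hom (haus X) (A, B) \<le> (SUP z\<in>B. hom X (x, z))"
      using that x by (intro hom_haus_le)
    also have "\<dots> \<le> (SUP w\<in>f ` B. hom Y (y, w))"
    proof (rule SUP_least)
      fix z assume z: "z \<in> B"
      then have "hom X (x, z) \<le> hom Y (y, f z)"
        using f that x unfolding vfunctor_def by blast
      then show "hom X (x, z) \<le> (SUP w\<in>f ` B. hom Y (y, w))"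
        using z by (intro SUP_upper2) auto
    qed
    finally show "hom (haus X) (A, B) \<le> (SUP w\<in>f ` B. hom Y (y, w))" .
  qed (use im that in auto)
  then show ?thesis
    using im by (auto simp: vfunctor_def haus_map_def)
qed

lemma vfunctor_haus_unit:
  "vcategory X \<Longrightarrow> vfunctor X (haus X) (haus_unit X)"
  by (auto simp: vfunctor_def haus_unit_def hom_haus)

lemma vfunctor_haus_mult:
  fixes X :: "('a, 'v::comm_unital_quantale) vcat"
  assumes "vcategory X"
  shows "vfunctor (haus (haus X)) (haus X) (haus_mult X)"
proof -
  have "hom (haus (haus X)) (\<A>, \<B>) \<le> hom (haus X) (\<Union>\<A>, \<Union>\<B>)"
    if \<A>: "\<A> \<subseteq> Pow (ob X)" and \<B>: "\<B> \<subseteq> Pow (ob X)" for \<A> \<B>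
  proof (rule le_hom_haus)
    fix x assume "x \<in> \<Union>\<A>"
    then obtain A where A: "A \<in> \<A>" "x \<in> A" by auto
    have "hom (haus (haus X)) (\<A>, \<B>) \<le> (SUP B\<in>\<B>. hom (haus X) (A, B))"
      using \<A> \<B> A by (intro hom_haus_le) auto
    also have "\<dots> \<le> (SUP B\<in>\<B>. SUP y\<in>B. hom X (x, y))"
      using \<A> \<B> A by (intro SUP_mono) (blast intro: hom_haus_le)
    also have "\<dots> \<le> (SUP y\<in>\<Union>\<B>. hom X (x, y))"
      by (intro SUP_least SUP_upper) blast
    finally show "hom (haus (haus X)) (\<A>, \<B>) \<le> (SUP y\<in>\<Union>\<B>. hom X (x, y))" .
  qed (use \<A> \<B> in auto)
  then show ?thesis
    by (auto simp: vfunctor_def haus_mult_def)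
qed

lemma haus_map_id: "haus_map X (\<lambda>x\<in>ob X. x) = (\<lambda>A\<in>ob (haus X). A)"
  unfolding haus_map_def ob_haus by (intro restrict_ext) auto

lemma haus_map_compose:
  assumes "vfunctor X Y f"
  shows "haus_map X (compose (ob X) g f) = compose (ob (haus X)) (haus_map Y g) (haus_map X f)"
proof -
  have "f ` A \<subseteq> ob Y" if "A \<subseteq> ob X" for A
    using assms that by (auto simp: vfunctor_def)
  moreover have "compose (ob X) g f ` A = g ` f ` A" if "A \<subseteq> ob X" for A
    using that by (force simp: compose_def)
  ultimately show ?thesis
    by (simp add: haus_map_def compose_def fun_eq_iff)
qed

lemma haus_unit_natural:
  assumes "vfunctor X Y f"
  shows "compose (ob X) (haus_map X f) (haus_unit X) = compose (ob X) (haus_unit Y) f"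
proof -
  have "f x \<in> ob Y" if "x \<in> ob X" for x
    using assms that by (auto simp: vfunctor_def)
  then show ?thesis
    by (simp add: haus_map_def haus_unit_def compose_def fun_eq_iff)
qed

lemma haus_mult_natural:
  assumes "vfunctor X Y f"
  shows "compose (ob (haus (haus X))) (haus_map X f) (haus_mult X) =
    compose (ob (haus (haus X))) (haus_mult Y) (haus_map (haus X) (haus_map X f))"
proof (rule ext)
  fix \<A>
  have "f ` A \<subseteq> ob Y" if "A \<subseteq> ob X" for A
    using assms that by (auto simp: vfunctor_def)
  then have "(`) f ` \<A> \<subseteq> Pow (ob Y)" if "\<A> \<subseteq> Pow (ob X)"
    using that by blast
  moreover have "haus_map X f ` \<A> = (`) f ` \<A>" "\<Union>\<A> \<subseteq> ob X" if "\<A> \<subseteq> Pow (ob X)"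
    using that by (auto simp: haus_map_def intro!: image_cong)
  ultimately show "compose (ob (haus (haus X))) (haus_map X f) (haus_mult X) \<A> =
    compose (ob (haus (haus X))) (haus_mult Y) (haus_map (haus X) (haus_map X f)) \<A>"
    by (simp add: haus_map_def[of X] haus_map_def[of "haus X"] haus_mult_def compose_def image_Union)
qed

lemma haus_mult_unit:
  "compose (ob (haus X)) (haus_mult X) (haus_unit (haus X)) = (\<lambda>A\<in>ob (haus X). A)"
  "compose (ob (haus X)) (haus_mult X) (haus_map X (haus_unit X)) = (\<lambda>A\<in>ob (haus X). A)"
proof -
  show "compose (ob (haus X)) (haus_mult X) (haus_unit (haus X)) = (\<lambda>A\<in>ob (haus X). A)"
    by (simp add: haus_unit_def haus_mult_def compose_def fun_eq_iff)
  have "haus_unit X ` A = (\<lambda>x. {x}) ` A" "(\<lambda>x. {x}) ` A \<subseteq> Pow (ob X)" if "A \<subseteq> ob X" for A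
    using that by (auto simp: haus_unit_def intro!: image_cong)
  then show "compose (ob (haus X)) (haus_mult X) (haus_map X (haus_unit X)) = (\<lambda>A\<in>ob (haus X). A)"
    by (simp add: haus_map_def haus_mult_def compose_def fun_eq_iff)
qed

lemma haus_mult_assoc:
  "compose (ob (haus (haus (haus X)))) (haus_mult X) (haus_mult (haus X)) =
   compose (ob (haus (haus (haus X)))) (haus_mult X) (haus_map (haus (haus X)) (haus_mult X))"
proof (rule ext)
  fix \<AA>
  have "haus_mult X ` \<AA> = Union ` \<AA>" "\<Union>\<AA> \<subseteq> Pow (ob X)" "Union ` \<AA> \<subseteq> Pow (ob X)"
    if "\<AA> \<subseteq> Pow (Pow (ob X))"
  proof -
    show "haus_mult X ` \<AA> = Union ` \<AA>"
      using that by (intro image_cong) (auto simp: haus_mult_def)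
    show "\<Union>\<AA> \<subseteq> Pow (ob X)" using that by blast
    show "Union ` \<AA> \<subseteq> Pow (ob X)" using that by blast
  qed
  moreover have "\<Union>(\<Union>\<AA>) = \<Union>(Union ` \<AA>)"
    by blast
  ultimately show "compose (ob (haus (haus (haus X)))) (haus_mult X) (haus_mult (haus X)) \<AA> =
    compose (ob (haus (haus (haus X)))) (haus_mult X) (haus_map (haus (haus X)) (haus_mult X)) \<AA>"
    by (simp add: haus_map_def haus_mult_def[of "haus X"] compose_def)
      (simp add: haus_mult_def)
qed

end

theory Submission
  imports Defs
begin

text \<open>
  By the Yoneda lemma the abstractly defined module \<open>\<tilde>H\<phi> = (Hy\<^sub>\<phi>)\<^sup>* \<cdot> (Hy\<^sub>X)\<^sub>*\<close> has the same
  explicit form as the Hausdorff structure itself: its value at \<open>(A, B)\<close> is the infimum over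
  \<open>x \<in> A\<close> of the suprema of \<open>\<phi>(x, y)\<close> over \<open>y \<in> B\<close> (lemma \<open>haus_mod_apply\<close>). Indeed
  \<open>(g\<^sup>* \<cdot> f\<^sub>*)(x, y)\<close> is the hom from \<open>f x\<close> to \<open>g y\<close>, and the hom in the category of presheaves
  from \<open>y\<^sub>X(x)\<close> to \<open>\<phi>(-, y)\<close> is \<open>\<phi>(x, y)\<close>.

  With this formula, the module laws of \<open>\<tilde>H\<phi>\<close> and lax functoriality both come from one inequality
  for infima of suprema in a quantale (lemma \<open>INF_SUP_mult_le\<close>). The formula also
  gives \<open>\<tilde>H(f\<^sub>*) = (Hf)\<^sub>*\<close> at once; as lower star is itself functorial, the monad laws are then the images of the monad laws of the Hausdorff monad.

  Naturality with respect to modules needs more than naturality with respect to functors.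
  For \<open>\<delta>\<close> it comes from the module law of \<open>\<phi>\<close> in its second variable. For \<open>\<nu>\<close>, both sides at
  \<open>(\<A>, B)\<close> equal the infimum of \<open>\<tilde>H\<phi>(A, B)\<close> over \<open>A \<in> \<A>\<close>: the supremum over \<open>\<B> \<subseteq> PY\<close> that
  defines the composite \<open>\<nu> \<cdot> \<tilde>H\<tilde>H\<phi>\<close> is attained at \<open>\<B> = {B}\<close>.
\<close>

section \<open>Infima and suprema in a quantale\<close>

lemma quantale_mult_SUP:
  fixes f :: "'i \<Rightarrow> 'v::comm_unital_quantale"
  shows "c * (SUP i\<in>I. f i) = (SUP i\<in>I. c * f i)"
  by (simp only: mult_Sup image_image)

lemma quantale_SUP_mult:
  fixes f :: "'i \<Rightarrow> 'v::comm_unital_quantale"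
  shows "(SUP i\<in>I. f i) * c = (SUP i\<in>I. f i * c)"
  by (simp only: mult.commute[of _ c] quantale_mult_SUP)

lemma INF_SUP_mult_le:
  fixes p :: "'a \<Rightarrow> 'b \<Rightarrow> 'v::comm_unital_quantale"
  assumes "\<And>x y z. x \<in> A \<Longrightarrow> y \<in> B \<Longrightarrow> z \<in> C \<Longrightarrow> p x y * q y z \<le> r x z"
  shows "(INF x\<in>A. SUP y\<in>B. p x y) * (INF y\<in>B. SUP z\<in>C. q y z) \<le> (INF x\<in>A. SUP z\<in>C. r x z)"
    (is "?P * ?Q \<le> _")
proof (rule INF_greatest)
  fix x assume x: "x \<in> A"
  have "?P * ?Q \<le> (SUP y\<in>B. p x y) * ?Q"
    using INF_lower[OF x] order_refl by (rule quantale_mult_mono)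
  also have "\<dots> = (SUP y\<in>B. p x y * ?Q)"
    by (rule quantale_SUP_mult)
  also have "\<dots> \<le> (SUP z\<in>C. r x z)"
  proof (rule SUP_least)
    fix y assume y: "y \<in> B"
    have "p x y * ?Q \<le> p x y * (SUP z\<in>C. q y z)"
      using INF_lower[OF y] by (rule quantale_mult_right_mono)
    also have "\<dots> = (SUP z\<in>C. p x y * q y z)"
      by (rule quantale_mult_SUP)
    also have "\<dots> \<le> (SUP z\<in>C. r x z)"
      using assms x y by (intro SUP_mono) blast
    finally show "p x y * ?Q \<le> (SUP z\<in>C. r x z)" .
  qed
  finally show "?P * ?Q \<le> (SUP z\<in>C. r x z)" .
qed

section \<open>Categories, modules and the stars of a functor\<close>

lemma vcategory_refl: "vcategory X \<Longrightarrow> x \<in> ob X \<Longrightarrow> 1 \<le> hom X (x, x)"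
  by (simp add: vcategory_def)

lemma vcategory_trans:
  "vcategory X \<Longrightarrow> x \<in> ob X \<Longrightarrow> y \<in> ob X \<Longrightarrow> z \<in> ob X \<Longrightarrow>
    hom X (x, y) * hom X (y, z) \<le> hom X (x, z)"
  unfolding vcategory_def by blast

lemma vmodule_left:
  "vmodule X Y \<phi> \<Longrightarrow> x' \<in> ob X \<Longrightarrow> x \<in> ob X \<Longrightarrow> y \<in> ob Y \<Longrightarrow> hom X (x', x) * \<phi> (x, y) \<le> \<phi> (x', y)"
  unfolding vmodule_def by blast

lemma vmodule_right:
  "vmodule X Y \<phi> \<Longrightarrow> x \<in> ob X \<Longrightarrow> y \<in> ob Y \<Longrightarrow> y' \<in> ob Y \<Longrightarrow> \<phi> (x, y) * hom Y (y, y') \<le> \<phi> (x, y')"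
  unfolding vmodule_def by blast

lemma vfunctor_ob: "vfunctor X Y f \<Longrightarrow> x \<in> ob X \<Longrightarrow> f x \<in> ob Y"
  by (auto simp: vfunctor_def)

lemma vfunctor_hom:
  "vfunctor X Y f \<Longrightarrow> x \<in> ob X \<Longrightarrow> y \<in> ob X \<Longrightarrow> hom X (x, y) \<le> hom Y (f x, f y)"
  unfolding vfunctor_def by blast

lemma mcomp_apply:
  "x \<in> ob X \<Longrightarrow> z \<in> ob Z \<Longrightarrow> mcomp X Y Z \<psi> \<phi> (x, z) = (SUP y\<in>ob Y. \<phi> (x, y) * \<psi> (y, z))"
  by (simp add: mcomp_def)

lemma mcomp_extensional: "mcomp X Y Z \<psi> \<phi> \<in> extensional (ob X \<times> ob Z)"
  by (simp add: mcomp_def)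

lemma lower_star_apply:
  "x \<in> ob X \<Longrightarrow> y \<in> ob Y \<Longrightarrow> lower_star X Y f (x, y) = hom Y (f x, y)"
  by (simp add: lower_star_def)

lemma lower_star_extensional: "lower_star X Y f \<in> extensional (ob X \<times> ob Y)"
  by (simp add: lower_star_def)

lemma module_eqI:
  assumes "\<phi> \<in> extensional (P \<times> Q)" "\<psi> \<in> extensional (P \<times> Q)"
    and "\<And>x y. x \<in> P \<Longrightarrow> y \<in> Q \<Longrightarrow> \<phi> (x, y) = \<psi> (x, y)"
  shows "\<phi> = \<psi>"
  by (rule extensionalityI[OF assms(1,2)]) (use assms(3) in auto)

lemma module_leI:
  fixes \<phi> :: "'a \<times> 'b \<Rightarrow> 'v::order"
  assumes "\<phi> \<in> extensional (P \<times> Q)" "\<psi> \<in> extensional (P \<times> Q)"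
    and "\<And>x y. x \<in> P \<Longrightarrow> y \<in> Q \<Longrightarrow> \<phi> (x, y) \<le> \<psi> (x, y)"
  shows "\<phi> \<le> \<psi>"
proof (rule le_funI)
  fix p
  show "\<phi> p \<le> \<psi> p"
  proof (cases "p \<in> P \<times> Q")
    case True
    then show ?thesis using assms(3) by auto
  next
    case False
    then show ?thesis
      by (simp only: extensional_arb[OF assms(1) False] extensional_arb[OF assms(2) False] order_refl)
  qed
qed

lemma vmodule_lower_star:
  fixes X :: "('a, 'v::comm_unital_quantale) vcat"
  assumes Y: "vcategory Y" and f: "vfunctor X Y f"
  shows "vmodule X Y (lower_star X Y f)"
  unfolding vmodule_def
proof (intro conjI ballI)
  show "lower_star X Y f \<in> extensional (ob X \<times> ob Y)"
    by (rule lower_star_extensional)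
next
  fix x' x y assume mem: "x' \<in> ob X" "x \<in> ob X" "y \<in> ob Y"
  have "hom X (x', x) * hom Y (f x, y) \<le> hom Y (f x', f x) * hom Y (f x, y)"
    using vfunctor_hom[OF f mem(1,2)] order_refl by (rule quantale_mult_mono)
  also have "\<dots> \<le> hom Y (f x', y)"
    using mem by (intro vcategory_trans[OF Y] vfunctor_ob[OF f])
  finally show "hom X (x', x) * lower_star X Y f (x, y) \<le> lower_star X Y f (x', y)"
    using mem by (simp add: lower_star_apply)
next
  fix x y y' assume mem: "x \<in> ob X" "y \<in> ob Y" "y' \<in> ob Y"
  then show "lower_star X Y f (x, y) * hom Y (y, y') \<le> lower_star X Y f (x, y')"
    using vcategory_trans[OF Y vfunctor_ob[OF f mem(1)]] by (simp add: lower_star_apply)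
qed

text \<open>Composing with \<open>f\<^sub>*\<close> on the right is substitution of \<open>f\<close> in the first variable.\<close>

lemma mcomp_lower_star_apply:
  fixes X :: "('a, 'v::comm_unital_quantale) vcat" and Y :: "('b, 'v) vcat"
  assumes Y: "vcategory Y" and f: "vfunctor X Y f" and \<psi>: "vmodule Y Z \<psi>"
    and x: "x \<in> ob X" and z: "z \<in> ob Z"
  shows "mcomp X Y Z \<psi> (lower_star X Y f) (x, z) = \<psi> (f x, z)"
proof -
  note fx = vfunctor_ob[OF f x]
  have "(SUP y\<in>ob Y. hom Y (f x, y) * \<psi> (y, z)) = \<psi> (f x, z)"
  proof (rule antisym)
    show "(SUP y\<in>ob Y. hom Y (f x, y) * \<psi> (y, z)) \<le> \<psi> (f x, z)"
      by (intro SUP_least vmodule_left[OF \<psi> fx _ z])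
    have "1 * \<psi> (f x, z) \<le> hom Y (f x, f x) * \<psi> (f x, z)"
      using vcategory_refl[OF Y fx] order_refl by (rule quantale_mult_mono)
    then show "\<psi> (f x, z) \<le> (SUP y\<in>ob Y. hom Y (f x, y) * \<psi> (y, z))"
      by (intro SUP_upper2[OF fx]) simp
  qed
  then show ?thesis
    using x z by (simp add: mcomp_apply lower_star_apply)
qed

lemma lower_star_compose:
  fixes X :: "('a, 'v::comm_unital_quantale) vcat" and Y :: "('b, 'v) vcat" and Z :: "('c, 'v) vcat"
  assumes "vcategory Y" "vcategory Z" "vfunctor X Y f" "vfunctor Y Z g"
  shows "mcomp X Y Z (lower_star Y Z g) (lower_star X Y f) = lower_star X Z (compose (ob X) g f)"
  by (rule module_eqI[OF mcomp_extensional lower_star_extensional])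
    (use assms in \<open>simp add: mcomp_lower_star_apply vmodule_lower_star lower_star_apply
      compose_eq vfunctor_ob\<close>)

lemma lower_star_id:
  assumes "vcategory X"
  shows "lower_star X X (\<lambda>x\<in>ob X. x) = hom X"
  using assms
  by (intro module_eqI[OF lower_star_extensional]) (auto simp: vcategory_def lower_star_apply)

lemma vfunctor_id: "vfunctor X X (\<lambda>x\<in>ob X. x)"
  by (simp add: vfunctor_def)

section \<open>Presheaves and the Yoneda lemma\<close>

lemma ob_presheaves:
  "t \<in> ob (presheaves X) \<longleftrightarrow>
    t \<in> extensional (ob X) \<and> (\<forall>x'\<in>ob X. \<forall>x\<in>ob X. hom X (x', x) * t x \<le> t x')"
  by (simp add: presheaves_def Let_def)

lemma hom_presheaves:
  "t \<in> ob (presheaves X) \<Longrightarrow> s \<in> ob (presheaves X) \<Longrightarrow>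
    hom (presheaves X) (t, s) = (INF x\<in>ob X. qhom (t x) (s x))"
  by (simp add: presheaves_def Let_def)

lemma le_hom_presheaves_iff:
  "t \<in> ob (presheaves X) \<Longrightarrow> s \<in> ob (presheaves X) \<Longrightarrow>
    v \<le> hom (presheaves X) (t, s) \<longleftrightarrow> (\<forall>x\<in>ob X. v * t x \<le> s x)"
  by (simp add: hom_presheaves le_INF_iff le_qhom_iff)

lemma vcategory_presheaves:
  fixes X :: "('a, 'v::comm_unital_quantale) vcat"
  shows "vcategory (presheaves X)"
  unfolding vcategory_def
proof (intro conjI ballI)
  show "hom (presheaves X) \<in> extensional (ob (presheaves X) \<times> ob (presheaves X))"
    by (simp add: presheaves_def Let_def)
next
  fix t assume "t \<in> ob (presheaves X)"
  then show "1 \<le> hom (presheaves X) (t, t)"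
    by (simp add: le_hom_presheaves_iff)
next
  fix t s r assume mem: "t \<in> ob (presheaves X)" "s \<in> ob (presheaves X)" "r \<in> ob (presheaves X)"
  let ?h = "hom (presheaves X)"
  have "?h (t, s) * ?h (s, r) * t x \<le> r x" if x: "x \<in> ob X" for x
  proof -
    have "?h (t, s) * ?h (s, r) * t x = ?h (s, r) * (?h (t, s) * t x)"
      by (simp add: ac_simps)
    also have "\<dots> \<le> ?h (s, r) * s x"
      using le_hom_presheaves_iff[OF mem(1,2)] x by (intro quantale_mult_right_mono) blast
    also have "\<dots> \<le> r x"
      using le_hom_presheaves_iff[OF mem(2,3)] x by blast
    finally show ?thesis .
  qed
  then show "?h (t, s) * ?h (s, r) \<le> ?h (t, r)"
    using mem by (simp add: le_hom_presheaves_iff)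
qed

lemma yoneda_in_presheaves:
  "vcategory X \<Longrightarrow> x \<in> ob X \<Longrightarrow> yoneda X x \<in> ob (presheaves X)"
  by (simp add: ob_presheaves yoneda_def vcategory_trans)

lemma yoneda_mod_in_presheaves:
  "vmodule X Y \<phi> \<Longrightarrow> y \<in> ob Y \<Longrightarrow> yoneda_mod X Y \<phi> y \<in> ob (presheaves X)"
  by (simp add: ob_presheaves yoneda_mod_def vmodule_left)

lemma yoneda_lemma:
  fixes X :: "('a, 'v::comm_unital_quantale) vcat"
  assumes X: "vcategory X" and x: "x \<in> ob X" and s: "s \<in> ob (presheaves X)"
  shows "hom (presheaves X) (yoneda X x, s) = s x"
proof (rule antisym)
  let ?v = "hom (presheaves X) (yoneda X x, s)"
  note le_iff = le_hom_presheaves_iff[OF yoneda_in_presheaves[OF X x] s]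
  have "?v * 1 \<le> ?v * yoneda X x x"
    using vcategory_refl[OF X x] x by (intro quantale_mult_right_mono) (simp add: yoneda_def)
  also have "\<dots> \<le> s x"
    using le_iff[of ?v] x by blast
  finally show "?v \<le> s x" by simp
  have "s x * yoneda X x x' \<le> s x'" if "x' \<in> ob X" for x'
    using s x that by (simp add: yoneda_def ob_presheaves mult.commute)
  then show "s x \<le> ?v"
    by (simp add: le_iff)
qed

section \<open>The explicit form of the extension\<close>

text \<open>The composite \<open>g\<^sup>* \<cdot> f\<^sub>*\<close> is the hom of the common codomain \<open>W\<close> restricted along \<open>f\<close> and \<open>g\<close>.\<close>

lemma mcomp_upper_star_lower_star:
  fixes W :: "('c, 'v::comm_unital_quantale) vcat"
  assumes W: "vcategory W" and x: "x \<in> ob X" "f x \<in> ob W" and y: "y \<in> ob Y" "g y \<in> ob W"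
  shows "mcomp X W Y (upper_star Y W g) (lower_star X W f) (x, y) = hom W (f x, g y)"
proof -
  have "(SUP w\<in>ob W. hom W (f x, w) * hom W (w, g y)) = hom W (f x, g y)"
  proof (rule antisym)
    show "(SUP w\<in>ob W. hom W (f x, w) * hom W (w, g y)) \<le> hom W (f x, g y)"
      by (intro SUP_least vcategory_trans[OF W x(2) _ y(2)])
    have "1 * hom W (f x, g y) \<le> hom W (f x, f x) * hom W (f x, g y)"
      using vcategory_refl[OF W x(2)] order_refl by (rule quantale_mult_mono)
    then show "hom W (f x, g y) \<le> (SUP w\<in>ob W. hom W (f x, w) * hom W (w, g y))"
      by (intro SUP_upper2[OF x(2)]) simp
  qed
  then show ?thesis
    using x y by (simp add: mcomp_apply lower_star_apply upper_star_def)
qed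

lemma haus_mod_extensional: "haus_mod X Y \<phi> \<in> extensional (ob (haus X) \<times> ob (haus Y))"
  unfolding haus_mod_def by (rule mcomp_extensional)

lemma haus_mod_apply:
  fixes X :: "('a, 'v::comm_unital_quantale) vcat" and Y :: "('b, 'v) vcat"
  assumes X: "vcategory X" and \<phi>: "vmodule X Y \<phi>" and A: "A \<subseteq> ob X" and B: "B \<subseteq> ob Y"
  shows "haus_mod X Y \<phi> (A, B) = (INF x\<in>A. SUP y\<in>B. \<phi> (x, y))"
proof -
  let ?P = "presheaves X"
  have yA: "yoneda X ` A \<subseteq> ob ?P" and yB: "yoneda_mod X Y \<phi> ` B \<subseteq> ob ?P"
    using A B yoneda_in_presheaves[OF X] yoneda_mod_in_presheaves[OF \<phi>] by blast+
  have "haus_mod X Y \<phi> (A, B) = hom (haus ?P) (yoneda X ` A, yoneda_mod X Y \<phi> ` B)"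
    unfolding haus_mod_def
    by (subst mcomp_upper_star_lower_star[OF vcategory_haus[OF vcategory_presheaves]])
      (use A B yA yB in \<open>simp_all add: haus_map_def\<close>)
  also have "\<dots> = (INF x\<in>A. SUP y\<in>B. hom ?P (yoneda X x, yoneda_mod X Y \<phi> y))"
    by (simp add: hom_haus[OF yA yB] image_image)
  also have "\<dots> = (INF x\<in>A. SUP y\<in>B. \<phi> (x, y))"
  proof (intro INF_cong SUP_cong refl)
    fix x y assume "x \<in> A" "y \<in> B"
    then have mem: "x \<in> ob X" "y \<in> ob Y" using A B by auto
    then show "hom ?P (yoneda X x, yoneda_mod X Y \<phi> y) = \<phi> (x, y)"
      by (subst yoneda_lemma[OF X mem(1) yoneda_mod_in_presheaves[OF \<phi> mem(2)]])
        (simp add: yoneda_mod_def)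
  qed
  finally show ?thesis .
qed

section \<open>The extension is a lax functor\<close>

lemma vmodule_haus_mod:
  fixes X :: "('a, 'v::comm_unital_quantale) vcat" and Y :: "('b, 'v) vcat"
  assumes X: "vcategory X" and \<phi>: "vmodule X Y \<phi>"
  shows "vmodule (haus X) (haus Y) (haus_mod X Y \<phi>)"
  unfolding vmodule_def
proof (intro conjI ballI)
  show "haus_mod X Y \<phi> \<in> extensional (ob (haus X) \<times> ob (haus Y))"
    by (rule haus_mod_extensional)
next
  fix A' A B assume "A' \<in> ob (haus X)" "A \<in> ob (haus X)" "B \<in> ob (haus Y)"
  then have sub: "A' \<subseteq> ob X" "A \<subseteq> ob X" "B \<subseteq> ob Y" by auto
  show "hom (haus X) (A', A) * haus_mod X Y \<phi> (A, B) \<le> haus_mod X Y \<phi> (A', B)"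
    unfolding haus_mod_apply[OF X \<phi> sub(1,3)] haus_mod_apply[OF X \<phi> sub(2,3)] hom_haus[OF sub(1,2)]
    by (intro INF_SUP_mult_le vmodule_left[OF \<phi>]) (use sub in auto)
next
  fix A B B' assume "A \<in> ob (haus X)" "B \<in> ob (haus Y)" "B' \<in> ob (haus Y)"
  then have sub: "A \<subseteq> ob X" "B \<subseteq> ob Y" "B' \<subseteq> ob Y" by auto
  show "haus_mod X Y \<phi> (A, B) * hom (haus Y) (B, B') \<le> haus_mod X Y \<phi> (A, B')"
    unfolding haus_mod_apply[OF X \<phi> sub(1,2)] haus_mod_apply[OF X \<phi> sub(1,3)] hom_haus[OF sub(2,3)]
    by (intro INF_SUP_mult_le vmodule_right[OF \<phi>]) (use sub in auto)
qed

lemma haus_mod_mono: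
  fixes X :: "('a, 'v::comm_unital_quantale) vcat"
  assumes X: "vcategory X" and \<phi>: "vmodule X Y \<phi>" "vmodule X Y \<phi>'" and le: "\<phi> \<le> \<phi>'"
  shows "haus_mod X Y \<phi> \<le> haus_mod X Y \<phi>'"
proof (rule module_leI[OF haus_mod_extensional haus_mod_extensional])
  fix A B assume "A \<in> ob (haus X)" "B \<in> ob (haus Y)"
  then show "haus_mod X Y \<phi> (A, B) \<le> haus_mod X Y \<phi>' (A, B)"
    using le by (simp add: haus_mod_apply[OF X \<phi>(1)] haus_mod_apply[OF X \<phi>(2)])
      (intro INF_mono' SUP_mono', simp add: le_funD)
qed

lemma vmodule_mcomp:
  fixes X :: "('a, 'v::comm_unital_quantale) vcat" and Y :: "('b, 'v) vcat" and Z :: "('c, 'v) vcat"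
  assumes \<phi>: "vmodule X Y \<phi>" and \<psi>: "vmodule Y Z \<psi>"
  shows "vmodule X Z (mcomp X Y Z \<psi> \<phi>)"
  unfolding vmodule_def
proof (intro conjI ballI)
  show "mcomp X Y Z \<psi> \<phi> \<in> extensional (ob X \<times> ob Z)"
    by (rule mcomp_extensional)
next
  fix x' x z assume mem: "x' \<in> ob X" "x \<in> ob X" "z \<in> ob Z"
  have "hom X (x', x) * (\<phi> (x, y) * \<psi> (y, z)) \<le> \<phi> (x', y) * \<psi> (y, z)" if "y \<in> ob Y" for y
    using quantale_mult_mono[OF vmodule_left[OF \<phi> mem(1,2) that] order_refl]
    by (simp add: mult.assoc)
  then show "hom X (x', x) * mcomp X Y Z \<psi> \<phi> (x, z) \<le> mcomp X Y Z \<psi> \<phi> (x', z)"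
    using mem by (simp add: mcomp_apply quantale_mult_SUP) (intro SUP_mono, blast)
next
  fix x z z' assume mem: "x \<in> ob X" "z \<in> ob Z" "z' \<in> ob Z"
  have "\<phi> (x, y) * \<psi> (y, z) * hom Z (z, z') \<le> \<phi> (x, y) * \<psi> (y, z')" if "y \<in> ob Y" for y
    using quantale_mult_right_mono[OF vmodule_right[OF \<psi> that mem(2,3)]]
    by (simp add: mult.assoc)
  then show "mcomp X Y Z \<psi> \<phi> (x, z) * hom Z (z, z') \<le> mcomp X Y Z \<psi> \<phi> (x, z')"
    using mem by (simp add: mcomp_apply quantale_SUP_mult) (intro SUP_mono, blast)
qed

lemma haus_mod_mcomp_le:
  fixes X :: "('a, 'v::comm_unital_quantale) vcat" and Y :: "('b, 'v) vcat" and Z :: "('c, 'v) vcat"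
  assumes X: "vcategory X" and Y: "vcategory Y" and \<phi>: "vmodule X Y \<phi>" and \<psi>: "vmodule Y Z \<psi>"
  shows "mcomp (haus X) (haus Y) (haus Z) (haus_mod Y Z \<psi>) (haus_mod X Y \<phi>)
    \<le> haus_mod X Z (mcomp X Y Z \<psi> \<phi>)"
proof (rule module_leI[OF mcomp_extensional haus_mod_extensional])
  fix A C assume mem: "A \<in> ob (haus X)" "C \<in> ob (haus Z)"
  then have A: "A \<subseteq> ob X" and C: "C \<subseteq> ob Z" by auto
  have "haus_mod X Y \<phi> (A, B) * haus_mod Y Z \<psi> (B, C) \<le> haus_mod X Z (mcomp X Y Z \<psi> \<phi>) (A, C)"
    if B: "B \<subseteq> ob Y" for B
    unfolding haus_mod_apply[OF X \<phi> A B] haus_mod_apply[OF Y \<psi> B C]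
      haus_mod_apply[OF X vmodule_mcomp[OF \<phi> \<psi>] A C]
  proof (rule INF_SUP_mult_le)
    fix x y z assume "x \<in> A" "y \<in> B" "z \<in> C"
    then have "x \<in> ob X" "y \<in> ob Y" "z \<in> ob Z" using A B C by auto
    then show "\<phi> (x, y) * \<psi> (y, z) \<le> mcomp X Y Z \<psi> \<phi> (x, z)"
      by (auto simp: mcomp_apply intro: SUP_upper)
  qed
  then show "mcomp (haus X) (haus Y) (haus Z) (haus_mod Y Z \<psi>) (haus_mod X Y \<phi>) (A, C)
    \<le> haus_mod X Z (mcomp X Y Z \<psi> \<phi>) (A, C)"
    unfolding mcomp_apply[OF mem] by (intro SUP_least) simp
qed

section \<open>Compatibility of the extension with lower star\<close>

lemma haus_mod_lower_star:
  fixes X :: "('a, 'v::comm_unital_quantale) vcat" and Y :: "('b, 'v) vcat"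
  assumes X: "vcategory X" and Y: "vcategory Y" and f: "vfunctor X Y f"
  shows "haus_mod X Y (lower_star X Y f) = lower_star (haus X) (haus Y) (haus_map X f)"
proof (rule module_eqI[OF haus_mod_extensional lower_star_extensional])
  fix A B assume mem: "A \<in> ob (haus X)" "B \<in> ob (haus Y)"
  then have A: "A \<subseteq> ob X" and B: "B \<subseteq> ob Y" by auto
  have fA: "f ` A \<subseteq> ob Y" using A vfunctor_ob[OF f] by blast
  have "haus_mod X Y (lower_star X Y f) (A, B) = (INF x\<in>A. SUP y\<in>B. lower_star X Y f (x, y))"
    by (rule haus_mod_apply[OF X vmodule_lower_star[OF Y f] A B])
  also have "\<dots> = (INF x\<in>A. SUP y\<in>B. hom Y (f x, y))"
    using A B by (intro INF_cong SUP_cong refl) (simp add: lower_star_apply subset_iff)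
  also have "\<dots> = hom (haus Y) (f ` A, B)"
    by (simp add: hom_haus[OF fA B] image_image)
  also have "\<dots> = lower_star (haus X) (haus Y) (haus_map X f) (A, B)"
    using mem by (simp add: lower_star_apply haus_map_def)
  finally show "haus_mod X Y (lower_star X Y f) (A, B) = \<dots>" .
qed

lemma haus_mod_hom:
  assumes X: "vcategory X"
  shows "haus_mod X X (hom X) = hom (haus X)"
  using haus_mod_lower_star[OF X X vfunctor_id]
  by (simp only: lower_star_id[OF X] haus_map_id lower_star_id[OF vcategory_haus[OF X]])

section \<open>Naturality with respect to modules\<close>

lemma haus_delta_natural:
  fixes X :: "('a, 'v::comm_unital_quantale) vcat" and Y :: "('b, 'v) vcat"
  assumes X: "vcategory X" and Y: "vcategory Y" and \<phi>: "vmodule X Y \<phi>"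
  shows "mcomp X (haus X) (haus Y) (haus_mod X Y \<phi>) (haus_delta X) =
    mcomp X Y (haus Y) (haus_delta Y) \<phi>"
proof (rule module_eqI[OF mcomp_extensional mcomp_extensional])
  fix x B assume mem: "x \<in> ob X" "B \<in> ob (haus Y)"
  then have B: "B \<subseteq> ob Y" by simp
  have "mcomp X (haus X) (haus Y) (haus_mod X Y \<phi>) (haus_delta X) (x, B) =
      haus_mod X Y \<phi> (haus_unit X x, B)"
    unfolding haus_delta_def
    by (rule mcomp_lower_star_apply[OF vcategory_haus[OF X] vfunctor_haus_unit[OF X]
      vmodule_haus_mod[OF X \<phi>] mem])
  also have "\<dots> = (SUP y\<in>B. \<phi> (x, y))"
    using mem by (simp add: haus_unit_def haus_mod_apply[OF X \<phi>])
  also have "\<dots> = (SUP y\<in>ob Y. \<phi> (x, y) * (SUP y'\<in>B. hom Y (y, y')))"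
  proof (rule antisym)
    show "(SUP y\<in>B. \<phi> (x, y)) \<le> (SUP y\<in>ob Y. \<phi> (x, y) * (SUP y'\<in>B. hom Y (y, y')))"
    proof (rule SUP_mono)
      fix y assume y: "y \<in> B"
      then have "1 \<le> (SUP y'\<in>B. hom Y (y, y'))"
        using B by (intro SUP_upper2[OF y] vcategory_refl[OF Y]) auto
      from quantale_mult_right_mono[OF this, of "\<phi> (x, y)"]
      show "\<exists>y\<^sub>0\<in>ob Y. \<phi> (x, y) \<le> \<phi> (x, y\<^sub>0) * (SUP y'\<in>B. hom Y (y\<^sub>0, y'))"
        using y B by auto
    qed
    show "(SUP y\<in>ob Y. \<phi> (x, y) * (SUP y'\<in>B. hom Y (y, y'))) \<le> (SUP y\<in>B. \<phi> (x, y))"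
      unfolding quantale_mult_SUP
      using B mem by (intro SUP_least) (rule SUP_upper2, assumption, rule vmodule_right[OF \<phi>], auto)
  qed
  also have "\<dots> = mcomp X Y (haus Y) (haus_delta Y) \<phi> (x, B)"
    unfolding mcomp_apply[OF mem] haus_delta_def
    using B by (intro SUP_cong refl) (simp add: lower_star_apply haus_unit_def hom_haus)
  finally show "mcomp X (haus X) (haus Y) (haus_mod X Y \<phi>) (haus_delta X) (x, B) = \<dots>" .
qed

lemma haus_nu_natural:
  fixes X :: "('a, 'v::comm_unital_quantale) vcat" and Y :: "('b, 'v) vcat"
  assumes X: "vcategory X" and Y: "vcategory Y" and \<phi>: "vmodule X Y \<phi>"
  shows "mcomp (haus (haus X)) (haus X) (haus Y) (haus_mod X Y \<phi>) (haus_nu X) =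
    mcomp (haus (haus X)) (haus (haus Y)) (haus Y) (haus_nu Y)
      (haus_mod (haus X) (haus Y) (haus_mod X Y \<phi>))"
proof (rule module_eqI[OF mcomp_extensional mcomp_extensional])
  fix \<A> B assume mem: "\<A> \<in> ob (haus (haus X))" "B \<in> ob (haus Y)"
  then have \<A>: "\<A> \<subseteq> Pow (ob X)" and B: "B \<subseteq> ob Y" by auto
  note HX = vcategory_haus[OF X] and HY = vcategory_haus[OF Y]
  note H\<phi> = vmodule_haus_mod[OF X \<phi>]
  let ?H = "haus_mod X Y \<phi>" and ?HH = "haus_mod (haus X) (haus Y) (haus_mod X Y \<phi>)"
  have nu: "haus_nu Y (\<B>, B) = hom (haus Y) (\<Union>\<B>, B)" if "\<B> \<subseteq> Pow (ob Y)" for \<B>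
    using that B by (simp add: haus_nu_def lower_star_apply haus_mult_def)
  have HH: "?HH (\<A>, \<B>) = (INF A\<in>\<A>. SUP B'\<in>\<B>. ?H (A, B'))" if "\<B> \<subseteq> Pow (ob Y)" for \<B>
    using \<A> that by (intro haus_mod_apply[OF HX H\<phi>]) auto
  have "mcomp (haus (haus X)) (haus X) (haus Y) ?H (haus_nu X) (\<A>, B) = ?H (haus_mult X \<A>, B)"
    unfolding haus_nu_def
    by (rule mcomp_lower_star_apply[OF HX vfunctor_haus_mult[OF X] H\<phi> mem])
  also have "\<dots> = (INF x\<in>\<Union>\<A>. SUP y\<in>B. \<phi> (x, y))"
    using \<A> B mem by (subst haus_mod_apply[OF X \<phi>]) (auto simp: haus_mult_def)
  also have "\<dots> = (INF A\<in>\<A>. INF x\<in>A. SUP y\<in>B. \<phi> (x, y))"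
    by (rule antisym) (auto intro!: INF_greatest intro: INF_lower INF_lower2)
  also have "\<dots> = (INF A\<in>\<A>. ?H (A, B))"
    using \<A> B by (intro INF_cong refl) (auto simp: haus_mod_apply[OF X \<phi>])
  also have "\<dots> = (SUP \<B>\<in>ob (haus (haus Y)). ?HH (\<A>, \<B>) * haus_nu Y (\<B>, B))"
  proof (rule antisym)
    have B1: "{B} \<in> ob (haus (haus Y))" using B by simp
    have "(INF A\<in>\<A>. ?H (A, B)) * 1 \<le> ?HH (\<A>, {B}) * haus_nu Y ({B}, B)"
      using B vcategory_refl[OF HY mem(2)] by (intro quantale_mult_mono) (simp_all add: HH nu)
    then show "(INF A\<in>\<A>. ?H (A, B)) \<le> (SUP \<B>\<in>ob (haus (haus Y)). ?HH (\<A>, \<B>) * haus_nu Y (\<B>, B))"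
      by (intro SUP_upper2[OF B1]) simp
    show "(SUP \<B>\<in>ob (haus (haus Y)). ?HH (\<A>, \<B>) * haus_nu Y (\<B>, B)) \<le> (INF A\<in>\<A>. ?H (A, B))"
    proof (rule SUP_least)
      fix \<B> assume "\<B> \<in> ob (haus (haus Y))"
      then have \<B>: "\<B> \<subseteq> Pow (ob Y)" by simp
      have union_le: "hom (haus Y) (\<Union>\<B>, B) \<le> (INF B'\<in>\<B>. hom (haus Y) (B', B))"
      proof (rule INF_greatest)
        fix B' assume B': "B' \<in> \<B>"
        then have "hom (haus Y) (\<Union>\<B>, B) = (INF y\<in>\<Union>\<B>. SUP y'\<in>B. hom Y (y, y'))"
          using \<B> B by (intro hom_haus) auto
        also have "\<dots> \<le> (INF y\<in>B'. SUP y'\<in>B. hom Y (y, y'))"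
          using B' by (intro INF_superset_mono) auto
        also have "\<dots> = hom (haus Y) (B', B)"
          using \<B> B B' by (intro hom_haus[symmetric]) auto
        finally show "hom (haus Y) (\<Union>\<B>, B) \<le> hom (haus Y) (B', B)" .
      qed
      \<comment> \<open>suprema over a one-element index set give the second factor the form of an infimum of suprema\<close>
      have "?HH (\<A>, \<B>) * haus_nu Y (\<B>, B)
          \<le> ?HH (\<A>, \<B>) * (INF B'\<in>\<B>. SUP _\<in>{()}. hom (haus Y) (B', B))"
        using quantale_mult_right_mono[OF union_le] by (simp add: nu[OF \<B>])
      also have "\<dots> \<le> (INF A\<in>\<A>. SUP _\<in>{()}. ?H (A, B))"
        unfolding HH[OF \<B>]
        using \<A> \<B> mem by (intro INF_SUP_mult_le vmodule_right[OF H\<phi>]) auto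
      finally show "?HH (\<A>, \<B>) * haus_nu Y (\<B>, B) \<le> (INF A\<in>\<A>. ?H (A, B))"
        by simp
    qed
  qed
  also have "\<dots> = mcomp (haus (haus X)) (haus (haus Y)) (haus Y) (haus_nu Y) ?HH (\<A>, B)"
    by (rule mcomp_apply[OF mem, symmetric])
  finally show "mcomp (haus (haus X)) (haus X) (haus Y) ?H (haus_nu X) (\<A>, B) = \<dots>" .
qed

section \<open>The monad laws\<close>

lemma haus_nu_delta:
  fixes X :: "('a, 'v::comm_unital_quantale) vcat"
  assumes X: "vcategory X"
  shows "mcomp (haus X) (haus (haus X)) (haus X) (haus_nu X) (haus_delta (haus X)) = hom (haus X)"
    and "mcomp (haus X) (haus (haus X)) (haus X) (haus_nu X) (haus_mod X (haus X) (haus_delta X)) =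
      hom (haus X)"
proof -
  note HX = vcategory_haus[OF X]
  note HHX = vcategory_haus[OF HX]
  note unit = vfunctor_haus_unit[OF X] and mult = vfunctor_haus_mult[OF X]
  show "mcomp (haus X) (haus (haus X)) (haus X) (haus_nu X) (haus_delta (haus X)) = hom (haus X)"
    unfolding haus_nu_def haus_delta_def lower_star_compose[OF HHX HX vfunctor_haus_unit[OF HX] mult]
      haus_mult_unit(1)
    by (rule lower_star_id[OF HX])
  show "mcomp (haus X) (haus (haus X)) (haus X) (haus_nu X) (haus_mod X (haus X) (haus_delta X)) =
      hom (haus X)"
    unfolding haus_nu_def haus_delta_def haus_mod_lower_star[OF X HX unit]
      lower_star_compose[OF HHX HX vfunctor_haus_map[OF unit] mult] haus_mult_unit(2)
    by (rule lower_star_id[OF HX])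
qed

lemma haus_nu_assoc:
  fixes X :: "('a, 'v::comm_unital_quantale) vcat"
  assumes X: "vcategory X"
  shows "mcomp (haus (haus (haus X))) (haus (haus X)) (haus X) (haus_nu X) (haus_nu (haus X)) =
    mcomp (haus (haus (haus X))) (haus (haus X)) (haus X) (haus_nu X)
      (haus_mod (haus (haus X)) (haus X) (haus_nu X))"
proof -
  note HX = vcategory_haus[OF X]
  note HHX = vcategory_haus[OF HX]
  note mult = vfunctor_haus_mult[OF X]
  show ?thesis
    unfolding haus_nu_def haus_mod_lower_star[OF HHX HX mult]
      lower_star_compose[OF HHX HX vfunctor_haus_mult[OF HX] mult]
      lower_star_compose[OF HHX HX vfunctor_haus_map[OF mult] mult]
    by (simp only: haus_mult_assoc)
qed

section \<open>The lax Hausdorff monad\<close>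

theorem theorem3:
  fixes X :: "('a, 'v::comm_unital_quantale) vcat"
    and Y :: "('b, 'v) vcat"
    and Z :: "('c, 'v) vcat"
  assumes "vcategory X" and "vcategory Y" and "vcategory Z"
  shows
    \<comment> \<open>lax functor\<close>
    "vcategory (haus X) \<and>
     (\<forall>\<phi>. vmodule X Y \<phi> \<longrightarrow> vmodule (haus X) (haus Y) (haus_mod X Y \<phi>)) \<and>
     (\<forall>\<phi> \<phi>'. vmodule X Y \<phi> \<longrightarrow> vmodule X Y \<phi>' \<longrightarrow> \<phi> \<le> \<phi>' \<longrightarrow>
        haus_mod X Y \<phi> \<le> haus_mod X Y \<phi>') \<and>
     hom (haus X) \<le> haus_mod X X (hom X) \<and>
     (\<forall>\<phi> \<psi>. vmodule X Y \<phi> \<longrightarrow> vmodule Y Z \<psi> \<longrightarrow>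
        mcomp (haus X) (haus Y) (haus Z) (haus_mod Y Z \<psi>) (haus_mod X Y \<phi>)
          \<le> haus_mod X Z (mcomp X Y Z \<psi> \<phi>)) \<and>
     \<comment> \<open>families of modules, natural with respect to modules\<close>
     vmodule X (haus X) (haus_delta X) \<and>
     vmodule (haus (haus X)) (haus X) (haus_nu X) \<and>
     (\<forall>\<phi>. vmodule X Y \<phi> \<longrightarrow>
        mcomp X (haus X) (haus Y) (haus_mod X Y \<phi>) (haus_delta X) =
        mcomp X Y (haus Y) (haus_delta Y) \<phi>) \<and>
     (\<forall>\<phi>. vmodule X Y \<phi> \<longrightarrow>
        mcomp (haus (haus X)) (haus X) (haus Y) (haus_mod X Y \<phi>) (haus_nu X) =
        mcomp (haus (haus X)) (haus (haus Y)) (haus Y) (haus_nu Y)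
          (haus_mod (haus X) (haus Y) (haus_mod X Y \<phi>))) \<and>
     \<comment> \<open>monad laws\<close>
     mcomp (haus X) (haus (haus X)) (haus X) (haus_nu X) (haus_delta (haus X)) = hom (haus X) \<and>
     mcomp (haus X) (haus (haus X)) (haus X) (haus_nu X) (haus_mod X (haus X) (haus_delta X)) =
       hom (haus X) \<and>
     mcomp (haus (haus (haus X))) (haus (haus X)) (haus X) (haus_nu X) (haus_nu (haus X)) =
     mcomp (haus (haus (haus X))) (haus (haus X)) (haus X) (haus_nu X)
       (haus_mod (haus (haus X)) (haus X) (haus_nu X)) \<and>
     \<comment> \<open>the Hausdorff monad is a lifting along lower star\<close>
     (\<forall>f. vfunctor X Y f \<longrightarrow>
        haus_mod X Y (lower_star X Y f) = lower_star (haus X) (haus Y) (haus_map X f)) \<and>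
     haus_delta X = lower_star X (haus X) (haus_unit X) \<and>
     haus_nu X = lower_star (haus (haus X)) (haus X) (haus_mult X)"
proof (intro conjI allI impI)
  note X = assms(1) and Y = assms(2)
  show "vcategory (haus X)"
    by (rule vcategory_haus[OF X])
  show "vmodule (haus X) (haus Y) (haus_mod X Y \<phi>)" if "vmodule X Y \<phi>" for \<phi>
    by (rule vmodule_haus_mod[OF X that])
  show "haus_mod X Y \<phi> \<le> haus_mod X Y \<phi>'" if "vmodule X Y \<phi>" "vmodule X Y \<phi>'" "\<phi> \<le> \<phi>'" for \<phi> \<phi>'
    by (rule haus_mod_mono[OF X that])
  show "hom (haus X) \<le> haus_mod X X (hom X)"
    by (simp add: haus_mod_hom[OF X])
  show "mcomp (haus X) (haus Y) (haus Z) (haus_mod Y Z \<psi>) (haus_mod X Y \<phi>)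
      \<le> haus_mod X Z (mcomp X Y Z \<psi> \<phi>)" if "vmodule X Y \<phi>" "vmodule Y Z \<psi>" for \<phi> \<psi>
    by (rule haus_mod_mcomp_le[OF X Y that])
  show "vmodule X (haus X) (haus_delta X)"
    unfolding haus_delta_def by (rule vmodule_lower_star[OF vcategory_haus vfunctor_haus_unit]) (fact X)+
  show "vmodule (haus (haus X)) (haus X) (haus_nu X)"
    unfolding haus_nu_def by (rule vmodule_lower_star[OF vcategory_haus vfunctor_haus_mult]) (fact X)+
qed (rule haus_delta_natural haus_nu_natural haus_nu_delta haus_nu_assoc haus_mod_lower_star
      haus_delta_def haus_nu_def; use assms in blast)+

end
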